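(* The metric dimension of the game graph $G=G(K(1,n))$ of two opposing kings on a $1\times n$ strip is $$\beta(G)=\begin{cases} 2 & \text{if } 2\leq n\leq 3,\\ 3 & \text{if } n>3.\end{cases}$$
   Context: Two opposing kings, $K$ and $k$, are placed on a $1\times n$ strip with squares $1,\dots,n$. The positions are: $K_ik_j$ with $1\le i,j\le n$, $i\neq j$ (king $K$ on square $i$ and king $k$ on square $j$); $K_i$ with $1\le i\le n$ (only $K$ remains, on square $i$); and $k_j$ with $1\le j\le n$ (only $k$ remains, on square $j$). A move takes any one king present on the strip from its square to an adjacent square of the strip; if that square is occupied by the opposing king, the opposing king is captured and removed. Kings may move to squares adjacent to the opposing king, and a lone king may continue to move. Moves of both players are available at every position. The game graph $G(K(1,n))$ is the digraph whose vertices are all of these positions, with an arc from a position $p$ to a position $q$ whenever there is a legal move from $p$ to $q$. (Explicitly: $K_ik_j\to K_{i'}k_j$ if $|i-i'|=1$, $i'\ne j$; $K_ik_j\to K_ik_{j'}$ if $|j-j'|=1$, $j'\neq i$; $K_ik_j\to K_j$ and $K_ik_j\to k_i$ if $|i-j|=1$; $K_i\to K_{i'}$ and $k_i\to k_{i'}$ if $|i-i'|=1$.) Signed distance: in a digraph, let $d(u,v)$ be the number of arcs in a shortest directed path from $u$ to $v$ ($\infty$ if there is none, $d(u,u)=0$). The signed distance is $$d_{\pm}(u,v)=\begin{cases} d(u,v) & \text{if there is a directed } uv\text{-path and } d(u,v)\le d(v,u),\\ -d(v,u) & \text{if there is a directed } vu\text{-path and } d(v,u)<d(u,v),\\ \infty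 & \text{if there is neither a directed } uv\text{-path nor a directed } vu\text{-path.}\end{cases}$$ Metric dimension: for an ordered set $S=(u_1,\dots,u_k)$ of vertices, the distance vector of a vertex $v$ is $(d_\pm(u_1,v),\dots,d_\pm(u_k,v))$. $S$ is a resolving set if distinct vertices of the graph have distinct distance vectors. The metric dimension $\beta(G)$ is the minimum cardinality of a resolving set. *)

theory Defs
  imports "Graph_Theory.Graph_Theory"
begin

section \<open>Signed distance and metric dimension of a digraph\<close>

context wf_digraph
begin

text \<open>With unit weights the library's \<open>\<mu>\<close> is the number of arcs of a shortest directed path
  (and \<open>\<infinity>\<close> if there is none).\<close>

definition distance :: "'a \<Rightarrow> 'a \<Rightarrow> ereal" where
  "distance u v = \<mu> (\<lambda>_. 1) u v"

definition signed_distance :: "'a \<Rightarrow> 'a \<Rightarrow> ereal" where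
  "signed_distance u v =
     (if u \<rightarrow>\<^sup>* v \<and> distance u v \<le> distance v u then distance u v
      else if v \<rightarrow>\<^sup>* u \<and> distance v u < distance u v then - distance v u
      else \<infinity>)"

text \<open>Ordered sets of vertices are lists without repetitions.\<close>

definition distance_vector :: "'a list \<Rightarrow> 'a \<Rightarrow> ereal list" where
  "distance_vector S v = map (\<lambda>u. signed_distance u v) S"

definition resolving_set :: "'a list \<Rightarrow> bool" where
  "resolving_set S \<longleftrightarrow>
     distinct S \<and> set S \<subseteq> verts G \<and> inj_on (distance_vector S) (verts G)"

text \<open>The set of lengths is nonempty whenever the digraph is finite, since any enumeration of all
  vertices is resolving: the signed distance from \<open>u\<close> to \<open>v\<close> is \<open>0\<close> only if \<open>u = v\<close>.\<close>

definition metric_dimension :: nat where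
  "metric_dimension = (LEAST k. \<exists>S. resolving_set S \<and> length S = k)"

end

section \<open>Two opposing kings on a strip\<close>

text \<open>\<open>Both i j\<close> stands for $K_i k_j$, \<open>Upper i\<close> for $K_i$ and \<open>Lower j\<close> for $k_j$.\<close>

datatype position = Both nat nat | Upper nat | Lower nat

definition positions :: "nat \<Rightarrow> position set" where
  "positions n =
     {Both i j | i j. i \<in> {1..n} \<and> j \<in> {1..n} \<and> i \<noteq> j}
     \<union> Upper ` {1..n} \<union> Lower ` {1..n}"

definition adjacent :: "nat \<Rightarrow> nat \<Rightarrow> bool" where
  "adjacent i j \<longleftrightarrow> \<bar>int i - int j\<bar> = 1"

text \<open>Staying on the strip is enforced by restricting to \<open>positions n\<close> in the game graph. A capturing
  king ends up on the square of the captured one.\<close>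

inductive move :: "position \<Rightarrow> position \<Rightarrow> bool" where
  upper_step: "adjacent i i' \<Longrightarrow> i' \<noteq> j \<Longrightarrow> move (Both i j) (Both i' j)"
| lower_step: "adjacent j j' \<Longrightarrow> j' \<noteq> i \<Longrightarrow> move (Both i j) (Both i j')"
| upper_captures: "adjacent i j \<Longrightarrow> move (Both i j) (Upper j)"
| lower_captures: "adjacent i j \<Longrightarrow> move (Both i j) (Lower i)"
| upper_alone: "adjacent i i' \<Longrightarrow> move (Upper i) (Upper i')"
| lower_alone: "adjacent i i' \<Longrightarrow> move (Lower i) (Lower i')"

definition kings_graph :: "nat \<Rightarrow> (position, position \<times> position) pre_digraph" where
  "kings_graph n =
     \<lparr>verts = positions n,
      arcs = {(p, q). p \<in> positions n \<and> q \<in> positions n \<and> move p q},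
      tail = fst, head = snd\<rparr>"

text \<open>Outside their locale, the notions above unfold only for well-formed digraphs.\<close>

lemma wf_digraph_kings_graph: "wf_digraph (kings_graph n)"
  by unfold_locales (auto simp: kings_graph_def)

end

theory Submission
  imports Defs
begin

text \<open>The kings cannot pass each other, so the positions with both kings split into the classes
  $i < j$ and $i > j$, with no path between them; the same holds for the positions of $K$ alone and of
  $k$ alone. From $K_1$ and $k_n$, the signed distances to $K_i k_j$ are $-j$ and $-(n + 1 - i)$ if
  $i < j$, and $-(i - 1)$ and $-(n - j)$ if $i > j$. Hence these two vertices resolve everything up to
  pairs from different classes, which do not collide for $n \<le> 3$ and are separated by adding
  $K_1 k_2$ for larger $n$. Conversely, a single vertex never separates all positions with only one
  king, and for $n \<ge> 4$ every pair of vertices leaves an explicit collision: a vertex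
  $K_i k_j$ leaves the opposite class unresolved, and no other single vertex resolves that class.\<close>

section \<open>Distances from a potential\<close>

context wf_digraph
begin

text \<open>Along an arc \<open>f\<close> drops by at most 1 and \<open>Q\<close> pulls back, so
  every walk to \<open>t\<close> starts in \<open>Q\<close> and has at least \<open>f\<close> arcs.
  Conversely, following strictly decreasing arcs from \<open>Q\<close> ends at \<open>t\<close>
  after at most \<open>f\<close> arcs.\<close>

lemma distance_eq_potential:
  fixes f :: "'a \<Rightarrow> nat"
  assumes t: "t \<in> verts G" "Q t" "f t = 0"
    and back_step: "\<And>p q. p \<rightarrow> q \<Longrightarrow> Q q \<Longrightarrow> Q p \<and> f p \<le> Suc (f q)"
    and forth_step: "\<And>p. p \<in> verts G \<Longrightarrow> Q p \<Longrightarrow> p \<noteq> t \<Longrightarrow> \<exists>q. p \<rightarrow> q \<and> Q q \<and> f q < f p"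
    and p: "p \<in> verts G"
  shows "p \<rightarrow>\<^sup>* t \<longleftrightarrow> Q p"
    and "Q p \<Longrightarrow> distance p t = ereal (f p)"
proof -
  have lower: "Q u \<and> real (f u) \<le> awalk_cost (\<lambda>_. 1) es" if "awalk u es t" for u es
    using that
  proof (induction es arbitrary: u)
    case Nil
    then show ?case using t by (auto simp: awalk_Nil_iff)
  next
    case (Cons e es)
    then have "u \<rightarrow> head G e" "awalk (head G e) es t"
      by (auto simp: awalk_Cons_iff in_arcs_imp_in_arcs_ends)
    with Cons.IH[of "head G e"] back_step[of u "head G e"] show ?case
      by fastforce
  qed
  have upper: "\<exists>es. awalk u es t \<and> awalk_cost (\<lambda>_. 1) es \<le> real (f u)"
    if "u \<in> verts G" "Q u" for u
    using that
  proof (induction "f u" arbitrary: u rule: less_induct)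
    case less
    show ?case
    proof (cases "u = t")
      case True
      then show ?thesis using t by (intro exI[of _ "[]"]) (auto simp: awalk_Nil_iff)
    next
      case False
      then obtain q where q: "u \<rightarrow> q" "Q q" "f q < f u"
        using forth_step less.prems by blast
      then obtain es where es: "awalk q es t" "awalk_cost (\<lambda>_. 1) es \<le> real (f q)"
        using less.hyps[of q] adj_in_verts by blast
      obtain e where "e \<in> arcs G" "tail G e = u" "head G e = q"
        using q(1) by (auto simp: arcs_ends_def arc_to_ends_def)
      then have "awalk u (e # es) t" "awalk_cost (\<lambda>_. 1) (e # es) \<le> real (f u)"
        using es q(3) by (auto simp: awalk_Cons_iff)
      then show ?thesis by blast
    qed
  qed
  show "p \<rightarrow>\<^sup>* t \<longleftrightarrow> Q p"
    using lower upper[OF p] unfolding reachable_awalk by blast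
  show "distance p t = ereal (f p)" if Qp: "Q p"
  proof (rule antisym)
    obtain es where "awalk p es t" "awalk_cost (\<lambda>_. 1) es \<le> real (f p)"
      using upper p Qp by blast
    then show "distance p t \<le> ereal (f p)"
      unfolding distance_def using min_cost_le_walk_cost[of p es t "\<lambda>_. 1"]
      by (meson ereal_less_eq(3) order_trans)
    show "ereal (f p) \<le> distance p t"
      unfolding distance_def \<mu>_def using lower by (auto intro!: INF_greatest)
  qed
qed

end

section \<open>Distances between positions\<close>

text \<open>Candidate for reachability: steps preserve the order of the kings, captures are
  irreversible, and any two-king position can end with either king on any square.\<close>

fun leads_to :: "position \<Rightarrow> position \<Rightarrow> bool" where
  "leads_to (Both i j) (Both i' j') = ((i < j) = (i' < j'))"
| "leads_to (Both i j) (Upper k) = True"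
| "leads_to (Both i j) (Lower k) = True"
| "leads_to (Upper i) (Upper k) = True"
| "leads_to (Lower i) (Lower k) = True"
| "leads_to p q = False"

text \<open>For $i < j$, the distance from $K_i k_j$ to $K_k$ is $k - i$ if $j \<le> k$, it is $j - i$ if
  $i < k < j$, and it is $j + 1 - k$ if $k \<le> i$, since then $K$ has to step away from square $k$ to
  capture; $k - 1$ in the formula below merges these cases. The other three formulas arise by
  reflecting the strip and by exchanging the kings.\<close>

fun moves :: "position \<Rightarrow> position \<Rightarrow> nat" where
  "moves (Both i j) (Both i' j') = (i - i') + (i' - i) + ((j - j') + (j' - j))"
| "moves (Both i j) (Upper k) =
     (if i < j then max j k - min i (k - 1) else max i (k + 1) - min j k)"
| "moves (Both i j) (Lower k) =
     (if i < j then max j (k + 1) - min i k else max i k - min j (k - 1))"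
| "moves (Upper i) (Upper k) = (i - k) + (k - i)"
| "moves (Lower i) (Lower k) = (i - k) + (k - i)"
| "moves p q = 0"

lemma adjacent_iff: "adjacent i j \<longleftrightarrow> j = Suc i \<or> i = Suc j"
  by (auto simp: adjacent_def)

lemma move_simps:
  "move (Both i j) (Both i' j') \<longleftrightarrow>
     adjacent i i' \<and> j' = j \<and> i' \<noteq> j \<or> adjacent j j' \<and> i' = i \<and> j' \<noteq> i"
  "move (Both i j) (Upper k) \<longleftrightarrow> adjacent i j \<and> k = j"
  "move (Both i j) (Lower k) \<longleftrightarrow> adjacent i j \<and> k = i"
  "move (Upper i) (Upper k) \<longleftrightarrow> adjacent i k"
  "move (Lower i) (Lower k) \<longleftrightarrow> adjacent i k"
  "\<not> move (Upper i) (Both i' j')" "\<not> move (Lower i) (Both i' j')"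
  "\<not> move (Upper i) (Lower k)" "\<not> move (Lower i) (Upper k)"
  by (auto simp: move.simps)

lemma positions_simps [simp]:
  "Both i j \<in> positions n \<longleftrightarrow> 1 \<le> i \<and> i \<le> n \<and> 1 \<le> j \<and> j \<le> n \<and> i \<noteq> j"
  "Upper k \<in> positions n \<longleftrightarrow> 1 \<le> k \<and> k \<le> n"
  "Lower k \<in> positions n \<longleftrightarrow> 1 \<le> k \<and> k \<le> n"
  by (auto simp: positions_def)

text \<open>The back condition of \<open>distance_eq_potential\<close>. A step cannot land on the
  other king, so the order \<open>i < j\<close> survives; the formulas change by at most 1 when one
  coordinate does, and a capture costs exactly one move more than the walk after it.\<close>

lemma moves_le_Suc:
  assumes "p \<in> positions n" "q \<in> positions n" "t \<in> positions n" "move p q" "leads_to q t"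
  shows "leads_to p t \<and> moves p t \<le> Suc (moves q t)"
  using assms(4)
proof cases
  case (upper_step i i' j)
  with assms have less: "i < j \<longleftrightarrow> i' < j" by (auto simp: adjacent_iff)
  have "i' = Suc i \<or> i = Suc i'" using upper_step by (simp add: adjacent_iff)
  then show ?thesis
    using assms less by (cases t; cases "i < j") (auto simp: upper_step(1,2))
next
  case (lower_step j j' i)
  with assms have less: "i < j \<longleftrightarrow> i < j'" by (auto simp: adjacent_iff)
  have "j' = Suc j \<or> j = Suc j'" using lower_step by (simp add: adjacent_iff)
  then show ?thesis
    using assms less by (cases t; cases "i < j") (auto simp: lower_step(1,2))
next
  case (upper_captures i j)
  with assms show ?thesis by (cases t) (auto simp: adjacent_iff)
next
  case (lower_captures i j)
  with assms show ?thesis by (cases t) (auto simp: adjacent_iff)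
next
  case (upper_alone i i')
  with assms show ?thesis by (cases t) (auto simp: adjacent_iff)
next
  case (lower_alone i i')
  with assms show ?thesis by (cases t) (auto simp: adjacent_iff)
qed

text \<open>The forth condition of \<open>distance_eq_potential\<close>.\<close>

lemma ex_move_closer:
  assumes "p \<in> positions n" "t \<in> positions n" "leads_to p t" "p \<noteq> t"
  shows "\<exists>q \<in> positions n. move p q \<and> leads_to q t \<and> moves q t < moves p t"
proof (cases p)
  case p: (Both i j)
  show ?thesis
  proof (cases t)
    case t: (Both i' j')
    show ?thesis
    proof (cases "i < j")
      case True
      \<comment> \<open>Outward steps come first, as they are never blocked. Once only inward steps
        remain, the target order \<open>i' < j'\<close> keeps the destination square free.\<close>
      consider "i' < i" | "j < j'" | "i < i'" "j' \<le> j" | "i = i'" "j' < j"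
        using assms p t by fastforce
      then show ?thesis
      proof cases
        case 1 with True assms show ?thesis
          by (intro bexI[of _ "Both (i - 1) j"]) (auto simp: p t move_simps adjacent_iff)
      next
        case 2 with True assms show ?thesis
          by (intro bexI[of _ "Both i (j + 1)"]) (auto simp: p t move_simps adjacent_iff)
      next
        case 3 with True assms show ?thesis
          by (intro bexI[of _ "Both (i + 1) j"]) (auto simp: p t move_simps adjacent_iff)
      next
        case 4 with True assms show ?thesis
          by (intro bexI[of _ "Both i (j - 1)"]) (auto simp: p t move_simps adjacent_iff)
      qed
    next
      case False
      consider "j' < j" | "i < i'" | "j < j'" "i' \<le> i" | "j = j'" "i' < i"
        using assms p t by fastforce
      then show ?thesis
      proof cases
        case 1 with False assms show ?thesis
          by (intro bexI[of _ "Both i (j - 1)"]) (auto simp: p t move_simps adjacent_iff)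
      next
        case 2 with False assms show ?thesis
          by (intro bexI[of _ "Both (i + 1) j"]) (auto simp: p t move_simps adjacent_iff)
      next
        case 3 with False assms show ?thesis
          by (intro bexI[of _ "Both i (j + 1)"]) (auto simp: p t move_simps adjacent_iff)
      next
        case 4 with False assms show ?thesis
          by (intro bexI[of _ "Both (i - 1) j"]) (auto simp: p t move_simps adjacent_iff)
      qed
    qed
  next
    case t: (Upper k)
    \<comment> \<open>Non-adjacent kings approach so that the capture happens as near as possible to
      square \<open>k\<close>: the king to be captured comes closer if that brings it towards
      \<open>k\<close>, otherwise the capturing king does. The \<open>Lower\<close> case is the same
      with the kings exchanged.\<close>
    consider "adjacent i j" | "i + 1 < j" "j \<le> k" | "i + 1 < j" "k < j"
      | "j + 1 < i" "k \<le> j" | "j + 1 < i" "j < k"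
      using assms unfolding p adjacent_iff by fastforce
    then show ?thesis
    proof cases
      case 1 with assms show ?thesis
        by (intro bexI[of _ "Upper j"]) (auto simp: p t move_simps adjacent_iff)
    next
      case 2 with assms show ?thesis
        by (intro bexI[of _ "Both (i + 1) j"]) (auto simp: p t move_simps adjacent_iff)
    next
      case 3 with assms show ?thesis
        by (intro bexI[of _ "Both i (j - 1)"]) (auto simp: p t move_simps adjacent_iff)
    next
      case 4 with assms show ?thesis
        by (intro bexI[of _ "Both (i - 1) j"]) (auto simp: p t move_simps adjacent_iff)
    next
      case 5 with assms show ?thesis
        by (intro bexI[of _ "Both i (j + 1)"]) (auto simp: p t move_simps adjacent_iff)
    qed
  next
    case t: (Lower k)
    consider "adjacent i j" | "i + 1 < j" "k \<le> i" | "i + 1 < j" "i < k"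
      | "j + 1 < i" "i \<le> k" | "j + 1 < i" "k < i"
      using assms unfolding p adjacent_iff by fastforce
    then show ?thesis
    proof cases
      case 1 with assms show ?thesis
        by (intro bexI[of _ "Lower i"]) (auto simp: p t move_simps adjacent_iff)
    next
      case 2 with assms show ?thesis
        by (intro bexI[of _ "Both i (j - 1)"]) (auto simp: p t move_simps adjacent_iff)
    next
      case 3 with assms show ?thesis
        by (intro bexI[of _ "Both (i + 1) j"]) (auto simp: p t move_simps adjacent_iff)
    next
      case 4 with assms show ?thesis
        by (intro bexI[of _ "Both i (j + 1)"]) (auto simp: p t move_simps adjacent_iff)
    next
      case 5 with assms show ?thesis
        by (intro bexI[of _ "Both (i - 1) j"]) (auto simp: p t move_simps adjacent_iff)
    qed
  qed
next
  case p: (Upper i)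
  then obtain k where "t = Upper k" using assms by (cases t) auto
  with p assms show ?thesis
    by (intro bexI[of _ "Upper (if i < k then i + 1 else i - 1)"])
      (auto simp: move_simps adjacent_iff)
next
  case p: (Lower i)
  then obtain k where "t = Lower k" using assms by (cases t) auto
  with p assms show ?thesis
    by (intro bexI[of _ "Lower (if i < k then i + 1 else i - 1)"])
      (auto simp: move_simps adjacent_iff)
qed

section \<open>Reachability and signed distance in the game graph\<close>

lemma verts_kings_graph [simp]: "verts (kings_graph n) = positions n"
  by (simp add: kings_graph_def)

lemma kings_graph_adj_iff:
  "u \<rightarrow>\<^bsub>kings_graph n\<^esub> v \<longleftrightarrow> u \<in> positions n \<and> v \<in> positions n \<and> move u v"
  by (auto simp: kings_graph_def arcs_ends_def arc_to_ends_def image_iff)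

lemma
  assumes "p \<in> positions n" "t \<in> positions n"
  shows kings_graph_reachable_iff: "p \<rightarrow>\<^sup>*\<^bsub>kings_graph n\<^esub> t \<longleftrightarrow> leads_to p t"
    and kings_graph_distance:
      "leads_to p t \<Longrightarrow> wf_digraph.distance (kings_graph n) p t = ereal (moves p t)"
proof -
  interpret wf_digraph "kings_graph n" by (rule wf_digraph_kings_graph)
  have t: "leads_to t t" "moves t t = 0" by (cases t; simp)+
  have forth_step: "\<exists>q. u \<rightarrow>\<^bsub>kings_graph n\<^esub> q \<and> leads_to q t \<and> moves q t < moves u t"
    if "u \<in> positions n" "leads_to u t" "u \<noteq> t" for u
    using ex_move_closer[OF that(1) assms(2) that(2,3)] that(1) by (auto simp: kings_graph_adj_iff)
  have back_step: "leads_to u t \<and> moves u t \<le> Suc (moves q t)"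
    if "u \<rightarrow>\<^bsub>kings_graph n\<^esub> q" "leads_to q t" for u q
    using moves_le_Suc that assms(2) by (auto simp: kings_graph_adj_iff)
  note potential = distance_eq_potential[where t = t and Q = "\<lambda>p. leads_to p t"
      and f = "\<lambda>p. moves p t" and p = p, unfolded verts_kings_graph,
      OF assms(2) t back_step forth_step assms(1)]
  show "p \<rightarrow>\<^sup>*\<^bsub>kings_graph n\<^esub> t \<longleftrightarrow> leads_to p t" by (rule potential)
  show "distance p t = ereal (moves p t)" if "leads_to p t"
    by (rule potential(2)) (simp_all add: that)
qed

definition sd :: "position \<Rightarrow> position \<Rightarrow> ereal" where
  "sd u v = (if leads_to u v then ereal (moves u v)
     else if leads_to v u then - ereal (moves v u) else \<infinity>)"

text \<open>When each position reaches the other, both distances agree; otherwise at least one is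
  infinite. So the comparison of distances reduces to reachability, and the sign only records the
  direction.\<close>

lemma kings_graph_signed_distance:
  assumes u: "u \<in> positions n" and v: "v \<in> positions n"
  shows "wf_digraph.signed_distance (kings_graph n) u v = sd u v"
proof -
  interpret wf_digraph "kings_graph n" by (rule wf_digraph_kings_graph)
  have sym: "moves u v = moves v u" if "leads_to u v" "leads_to v u"
    using that by (cases u; cases v) auto
  have inf: "distance p q = \<infinity>" if "p \<in> positions n" "q \<in> positions n" "\<not> leads_to p q" for p q
    using that by (simp add: distance_def shortest_path_inf kings_graph_reachable_iff)
  show ?thesis
    using sym by (cases "leads_to u v"; cases "leads_to v u")
      (auto simp: sd_def signed_distance_def kings_graph_reachable_iff kings_graph_distance inf u v)
qed

section \<open>Resolving sets\<close>

lemma kings_graph_resolving_set_iff: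
  "wf_digraph.resolving_set (kings_graph n) S \<longleftrightarrow>
     distinct S \<and> set S \<subseteq> positions n \<and>
     (\<forall>p \<in> positions n. \<forall>q \<in> positions n. (\<forall>u \<in> set S. sd u p = sd u q) \<longrightarrow> p = q)"
proof -
  interpret wf_digraph "kings_graph n" by (rule wf_digraph_kings_graph)
  show ?thesis
    unfolding resolving_set_def inj_on_def distance_vector_def
    by (auto simp: kings_graph_signed_distance subset_iff)
qed

declare sd_def [simp]

section \<open>Upper bound: small resolving sets\<close>

text \<open>For \<open>i < j\<close>, capturing moves $K$ away from square 1 and $k$ away from
  square \<open>n\<close>; for \<open>i > j\<close> it moves them towards these ends. This accounts
  for the shift by one between the two cases.\<close>

lemma sd_ends_Both:
  assumes "Both i j \<in> positions n"
  shows "sd (Upper 1) (Both i j) = - ereal (real (if i < j then j else i - 1))"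
    and "sd (Lower n) (Both i j) = - ereal (real (if i < j then n + 1 - i else n - j))"
  using assms by auto

lemma ends_resolve:
  assumes pq: "p \<in> positions n" "q \<in> positions n"
    and eq: "sd (Upper 1) p = sd (Upper 1) q" "sd (Lower n) p = sd (Lower n) q"
    and order: "\<And>i j i' j'. p = Both i j \<Longrightarrow> q = Both i' j' \<Longrightarrow> i < j \<longleftrightarrow> i' < j'"
  shows "p = q"
proof (cases "\<exists>i j i' j'. p = Both i j \<and> q = Both i' j'")
  case True
  then obtain i j i' j' where *: "p = Both i j" "q = Both i' j'" by blast
  have "i < j \<longleftrightarrow> i' < j'" using order * .
  moreover have "(if i < j then j else i - 1) = (if i' < j' then j' else i' - 1)"
    "(if i < j then n + 1 - i else n - j) = (if i' < j' then n + 1 - i' else n - j')"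
    using eq pq unfolding * by (simp_all only: sd_ends_Both ereal_uminus_eq_iff ereal.inject of_nat_eq_iff)
  ultimately show ?thesis
    using pq unfolding * by (auto split: if_splits)
next
  case False
  \<comment> \<open>From \<open>Upper 1\<close>, two-king positions have negative values,
    \<open>Upper\<close> positions nonnegative finite ones, and \<open>Lower\<close> positions the
    value $\<infinity>$, so different kinds never agree. A lone king is located by its distance from
    an end.\<close>
  with pq eq show ?thesis
    by (cases p; cases q) auto
qed

lemma resolving_set_ends:
  assumes "2 \<le> n" "n \<le> 3"
  shows "wf_digraph.resolving_set (kings_graph n) [Upper 1, Lower n]"
proof -
  have "p = q" if pq: "p \<in> positions n" "q \<in> positions n"
    and eq: "sd (Upper 1) p = sd (Upper 1) q" "sd (Lower n) p = sd (Lower n) q" for p q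
  proof (rule ends_resolve[OF pq eq])
    fix i j i' j'
    assume *: "p = Both i j" "q = Both i' j'"
    have "(if i < j then j else i - 1) = (if i' < j' then j' else i' - 1)"
      "(if i < j then n + 1 - i else n - j) = (if i' < j' then n + 1 - i' else n - j')"
      using eq pq unfolding * by (simp_all only: sd_ends_Both ereal_uminus_eq_iff ereal.inject of_nat_eq_iff)
    \<comment> \<open>If \<open>i < j\<close> and \<open>i' > j'\<close>, the equations give
      \<open>i' = j + 1\<close> and \<open>j' = i - 1\<close>; then \<open>i\<close> is at least 2,
      \<open>j\<close> at least 3, and \<open>i'\<close> at least 4, which exceeds
      \<open>n\<close>.\<close>
    then show "i < j \<longleftrightarrow> i' < j'"
      using assms pq unfolding * by (auto split: if_splits)
  qed
  then show ?thesis
    using assms unfolding kings_graph_resolving_set_iff by (simp del: sd_def)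
qed

lemma resolving_set_ends_Both:
  assumes "2 \<le> n"
  shows "wf_digraph.resolving_set (kings_graph n) [Upper 1, Lower n, Both 1 2]"
proof -
  have "p = q" if pq: "p \<in> positions n" "q \<in> positions n"
    and eq: "sd (Upper 1) p = sd (Upper 1) q" "sd (Lower n) p = sd (Lower n) q"
    and both: "sd (Both 1 2) p = sd (Both 1 2) q" for p q
  proof (rule ends_resolve[OF pq eq])
    fix i j i' j'
    assume "p = Both i j" "q = Both i' j'"
    \<comment> \<open>Among two-king positions, \<open>Both 1 2\<close> gives an infinite value
      exactly to those of the opposite order.\<close>
    then show "i < j \<longleftrightarrow> i' < j'"
      using both by (simp del: moves.simps split: if_splits)
  qed
  then show ?thesis
    using assms unfolding kings_graph_resolving_set_iff by (simp del: sd_def)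
qed

section \<open>Lower bound: collisions for one or two vertices\<close>

text \<open>Stated for sets, so that the order of the vertices and repetitions do not
  matter.\<close>

definition collide :: "nat \<Rightarrow> position set \<Rightarrow> bool" where
  "collide n U \<longleftrightarrow>
     (\<exists>p \<in> positions n. \<exists>q \<in> positions n. p \<noteq> q \<and> (\<forall>u \<in> U. sd u p = sd u q))"

lemma collideI:
  assumes "p \<in> positions n" "q \<in> positions n" "p \<noteq> q" "\<And>u. u \<in> U \<Longrightarrow> sd u p = sd u q"
  shows "collide n U"
  using assms unfolding collide_def by blast

text \<open>From \<open>Both i j\<close> with \<open>i < j\<close>, \<open>Upper (k + 1)\<close> and
  \<open>Lower k\<close> are always equally far; for \<open>i > j\<close> the roles swap. A lone
  king sees all positions of the other lone king at $\<infinity>$.\<close>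

lemma collide_singleton:
  assumes "2 \<le> n" "u \<in> positions n"
  shows "collide n {u}"
proof (cases u)
  case u: (Both i j)
  show ?thesis
  proof (cases "i < j")
    case True
    with u assms show ?thesis by (intro collideI[of "Upper 2" n "Lower 1"]) auto
  next
    case False
    with u assms show ?thesis by (intro collideI[of "Lower 2" n "Upper 1"]) auto
  qed
next
  case (Upper k)
  with assms show ?thesis by (intro collideI[of "Lower 1" n "Lower 2"]) auto
next
  case (Lower k)
  with assms show ?thesis by (intro collideI[of "Upper 1" n "Upper 2"]) auto
qed

lemma equidistant_less:
  assumes "4 \<le> n" "Both i j \<in> positions n" "i < j"
  obtains p q x y where "p \<noteq> x \<or> q \<noteq> y" "p < q" "x < y"
    "Both p q \<in> positions n" "Both x y \<in> positions n"
    "moves (Both i j) (Both p q) = moves (Both i j) (Both x y)"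
proof -
  obtain m where n: "n = m + 4"
    using assms(1) le_Suc_ex add.commute by metis
  have ij: "1 \<le> i" "j \<le> m + 4"
    using assms n by simp_all
  \<comment> \<open>Positions of this order form a triangle with grid distance. Away from its
    corners $(1,2)$, $(1,n)$, $(n-1,n)$ two positions at distance 1 serve; at the corners two at
    distance 2 do, and these need \<open>n\<close> at least 4.\<close>
  consider "2 \<le> i" "j \<le> m + 3" | "i = 1" "j = 2" | "i = 1" "3 \<le> j" "j \<le> m + 3"
    | "i = 1" "j = m + 4" | "2 \<le> i" "i \<le> m + 2" "j = m + 4" | "i = m + 3" "j = m + 4"
    using ij assms(3) by linarith
  then show thesis
  proof cases
    case 1
    then show thesis using assms(3) by (intro that[of "i - 1" i j "j + 1"]) (auto simp: n)
  next
    case 2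
    then show thesis by (intro that[of 1 2 4 3]) (auto simp: n)
  next
    case 3
    then show thesis by (intro that[of 1 1 "j - 1" "j + 1"]) (auto simp: n)
  next
    case 4
    then show thesis by (intro that[of 1 2 "m + 2" "m + 3"]) (auto simp: n)
  next
    case 5
    then show thesis by (intro that[of "i - 1" "i + 1" "m + 4" "m + 4"]) (auto simp: n)
  next
    case 6
    then show thesis by (intro that[of "m + 2" "m + 1" "m + 3" "m + 4"]) (auto simp: n)
  qed
qed

text \<open>\<open>Both i j\<close> is blind to the opposite order, so \<open>v\<close> alone would
  have to resolve that class. A two-king \<open>v\<close> of the opposite order does so at best at
  the price of being blind to the order \<open>i < j\<close>, where \<open>equidistant_less\<close>
  applies.\<close>

lemma collide_Both_less:
  assumes "4 \<le> n" "Both i j \<in> positions n" "i < j" "v \<in> positions n"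
  shows "collide n {Both i j, v}"
proof (cases v)
  case v: (Both x y)
  show ?thesis
  proof (cases "x < y")
    case True
    with v assms show ?thesis by (intro collideI[of "Both 2 1" n "Both 3 1"]) auto
  next
    case False
    obtain p q p' q' where *: "p \<noteq> p' \<or> q \<noteq> q'" "p < q" "p' < q'"
      "Both p q \<in> positions n" "Both p' q' \<in> positions n"
      "moves (Both i j) (Both p q) = moves (Both i j) (Both p' q')"
      using equidistant_less assms by metis
    with False v assms show ?thesis
      by (intro collideI[OF *(4,5)]) (auto simp del: moves.simps)
  qed
next
  case (Upper a)
  \<comment> \<open>For a lone king, \<open>Both 3 1\<close> and \<open>Both 3 2\<close> collide
    when the \<open>min\<close> in \<open>moves\<close> hides the second coordinate, and
    \<open>Both 2 1\<close> and \<open>Both 3 1\<close> when the \<open>max\<close> hides the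
    first.\<close>
  show ?thesis
  proof (cases "a = 1")
    case True
    with Upper assms show ?thesis by (intro collideI[of "Both 3 1" n "Both 3 2"]) auto
  next
    case False
    with Upper assms show ?thesis by (intro collideI[of "Both 2 1" n "Both 3 1"]) auto
  qed
next
  case (Lower b)
  show ?thesis
  proof (cases "b \<le> 2")
    case True
    with Lower assms show ?thesis by (intro collideI[of "Both 3 1" n "Both 3 2"]) auto
  next
    case False
    with Lower assms show ?thesis by (intro collideI[of "Both 2 1" n "Both 3 1"]) auto
  qed
qed

lemma collide_Upper_Lower:
  assumes "4 \<le> n" "Upper a \<in> positions n" "Lower b \<in> positions n"
  shows "collide n {Upper a, Lower b}"
proof -
  obtain m where n: "n = m + 4"
    using assms(1) le_Suc_ex add.commute by metis
  have ab: "1 \<le> a" "a \<le> m + 4" "1 \<le> b" "b \<le> m + 4"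
    using assms n by simp_all
  \<comment> \<open>In the first four cases a \<open>max\<close> or \<open>min\<close> in both
    formulas hides one coordinate near an end of the strip. The last two are the opposite ends,
    which resolve each order class, so the colliding positions are taken from different
    classes.\<close>
  then consider "3 \<le> a" "2 \<le> b" | "2 \<le> a" "3 \<le> b" | "a \<le> m + 3" "b \<le> m + 2"
    | "a \<le> m + 2" "b \<le> m + 3" | "a = 1" "b = m + 4" | "a = m + 4" "b = 1"
    by linarith
  then show ?thesis
  proof cases
    case 1
    then show ?thesis by (intro collideI[of "Both 1 2" n "Both 1 3"]) (auto simp: n)
  next
    case 2
    then show ?thesis by (intro collideI[of "Both 2 1" n "Both 3 1"]) (auto simp: n)
  next
    case 3
    then show ?thesis
      by (intro collideI[of "Both (m + 3) (m + 4)" n "Both (m + 2) (m + 4)"]) (auto simp: n)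
  next
    case 4
    then show ?thesis
      by (intro collideI[of "Both (m + 4) (m + 3)" n "Both (m + 4) (m + 2)"]) (auto simp: n)
  next
    case 5
    then show ?thesis by (intro collideI[of "Both 2 3" n "Both 4 1"]) (auto simp: n)
  next
    case 6
    then show ?thesis by (intro collideI[of "Both 3 2" n "Both 1 4"]) (auto simp: n)
  qed
qed

text \<open>Swapping the kings is a symmetry of the game that reverses their order, so collisions
  for \<open>i > j\<close> follow from those for \<open>i < j\<close>.\<close>

fun exchange :: "position \<Rightarrow> position" where
  "exchange (Both i j) = Both j i"
| "exchange (Upper i) = Lower i"
| "exchange (Lower i) = Upper i"

lemma exchange_in_positions [simp]: "exchange p \<in> positions n \<longleftrightarrow> p \<in> positions n"
  by (cases p) auto

lemma exchange_exchange [simp]: "exchange (exchange p) = p"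
  by (cases p) auto

lemma leads_to_exchange:
  assumes "u \<in> positions n" "p \<in> positions n"
  shows "leads_to (exchange u) (exchange p) \<longleftrightarrow> leads_to u p"
  using assms by (cases u; cases p) auto

lemma moves_exchange:
  assumes "u \<in> positions n" "p \<in> positions n"
  shows "moves (exchange u) (exchange p) = moves u p"
  using assms by (cases u; cases p) simp_all

lemma sd_exchange:
  assumes "u \<in> positions n" "p \<in> positions n"
  shows "sd (exchange u) (exchange p) = sd u p"
  unfolding sd_def using assms by (simp only: leads_to_exchange moves_exchange)

lemma collide_exchange:
  assumes "collide n {exchange u, exchange v}" "u \<in> positions n" "v \<in> positions n"
  shows "collide n {u, v}"
proof -
  obtain p q where *: "p \<in> positions n" "q \<in> positions n" "p \<noteq> q"
    "sd (exchange u) p = sd (exchange u) q" "sd (exchange v) p = sd (exchange v) q"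
    using assms(1) unfolding collide_def by blast
  have "sd w (exchange p) = sd w (exchange q)"
    if "w \<in> positions n" "sd (exchange w) p = sd (exchange w) q" for w
    using that *(1,2) sd_exchange[of w n "exchange p"] sd_exchange[of w n "exchange q"] by (simp del: sd_def)
  moreover have "exchange p \<noteq> exchange q"
    using *(3) exchange_exchange by metis
  ultimately show ?thesis
    using * assms(2,3) by (intro collideI[of "exchange p" n "exchange q"]) (auto simp del: sd_def)
qed

lemma collide_Both:
  assumes "4 \<le> n" "Both i j \<in> positions n" "v \<in> positions n"
  shows "collide n {Both i j, v}"
proof (cases "i < j")
  case True
  with assms show ?thesis by (intro collide_Both_less)
next
  case False
  with assms have "collide n {Both j i, exchange v}"
    by (intro collide_Both_less) auto
  then show ?thesis
    using assms by (simp add: collide_exchange)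
qed

lemma collide_pair:
  assumes "4 \<le> n" "u \<in> positions n" "v \<in> positions n"
  shows "collide n {u, v}"
proof -
  consider i j where "u = Both i j" | i j where "v = Both i j"
    | a b where "u = Upper a" "v = Lower b" | a b where "u = Lower b" "v = Upper a"
    | a b where "u = Upper a" "v = Upper b" | a b where "u = Lower a" "v = Lower b"
    by (cases u; cases v) blast+
  then show ?thesis
  proof cases
    case 1
    then show ?thesis using collide_Both assms by blast
  next
    case 2
    then show ?thesis using collide_Both assms insert_commute by metis
  next
    case 3
    then show ?thesis using collide_Upper_Lower assms by blast
  next
    case 4
    then show ?thesis using collide_Upper_Lower assms insert_commute by metis
  next
    case 5
    with assms(1) show ?thesis by (intro collideI[of "Lower 1" n "Lower 2"]) auto
  next
    case 6
    with assms(1) show ?thesis by (intro collideI[of "Upper 1" n "Upper 2"]) auto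
  qed
qed

section \<open>From collisions to the metric dimension\<close>

lemma resolving_set_not_collide:
  assumes "wf_digraph.resolving_set (kings_graph n) S" "set S \<subseteq> U"
  shows "\<not> collide n U"
  using assms unfolding kings_graph_resolving_set_iff collide_def by blast

lemma length_resolving_set_ge:
  assumes "2 \<le> n" and S: "wf_digraph.resolving_set (kings_graph n) S"
  shows "2 \<le> length S" and "4 \<le> n \<Longrightarrow> 3 \<le> length S"
proof -
  have mem: "set S \<subseteq> positions n"
    using S by (simp add: kings_graph_resolving_set_iff)
  \<comment> \<open>The inclusion form also rules out the empty list, using \<open>Upper 1\<close>
    as \<open>u\<close>.\<close>
  have "\<not> set S \<subseteq> {u}" if "u \<in> positions n" for u
    using resolving_set_not_collide[OF S] collide_singleton assms(1) that by blast
  moreover have "Upper 1 \<in> positions n"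
    using assms(1) by simp
  ultimately show two: "2 \<le> length S"
    using mem by (cases S; cases "tl S") fastforce+
  show "3 \<le> length S" if "4 \<le> n"
  proof (rule ccontr)
    assume "\<not> 3 \<le> length S"
    with two have "length S = Suc (Suc 0)" by simp
    then obtain u v where "S = [u, v]" by (auto simp: length_Suc_conv)
    with mem resolving_set_not_collide[OF S order_refl] collide_pair[of n u v] that
    show False by simp
  qed
qed

theorem theorem5p6:
  fixes n :: nat
  assumes "2 \<le> n"
  shows "wf_digraph.metric_dimension (kings_graph n) = (if n \<le> 3 then 2 else 3)"
proof -
  interpret wf_digraph "kings_graph n" by (rule wf_digraph_kings_graph)
  let ?S = "if n \<le> 3 then [Upper 1, Lower n] else [Upper 1, Lower n, Both 1 2]"
  have "resolving_set ?S"
    using assms resolving_set_ends resolving_set_ends_Both by simp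
  then show ?thesis
    unfolding metric_dimension_def using length_resolving_set_ge[OF assms]
    by (intro Least_equality) (auto intro!: exI[of _ ?S])
qed

end
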